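(* Let $(B_1,\cdot_1,[\cdot,\cdot,\cdot]_1)$ be a (finite-dimensional) transposed Poisson 3-Lie algebra and $(B_2,\cdot_2)$ a (finite-dimensional) commutative associative algebra over a field $\mathbb F$ of characteristic zero. For $x_i\in B_1$, $y_i\in B_2$, define linear maps $\cdot_{B_1\otimes B_2}:\otimes^2(B_1\otimes B_2)\to B_1\otimes B_2$ and $[\cdot,\cdot,\cdot]_{B_1\otimes B_2}:\otimes^3(B_1\otimes B_2)\to B_1\otimes B_2$ by $$(x_1\otimes y_1)\cdot_{B_1\otimes B_2}(x_2\otimes y_2)=(x_1\cdot_1x_2)\otimes(y_1\cdot_2y_2),$$ $$[x_1\otimes y_1,x_2\otimes y_2,x_3\otimes y_3]_{B_1\otimes B_2}=[x_1,x_2,x_3]_1\otimes(y_1\cdot_2y_2\cdot_2y_3).$$ Then $(B_1\otimes B_2,\cdot_{B_1\otimes B_2},[\cdot,\cdot,\cdot]_{B_1\otimes B_2})$ is a transposed Poisson 3-Lie algebra.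
   Context: A 3-Lie algebra is a vector space with a skew-symmetric trilinear bracket satisfying $[x_1,x_2,[x_3,x_4,x_5]]=[[x_1,x_2,x_3],x_4,x_5]+[x_3,[x_1,x_2,x_4],x_5]+[x_3,x_4,[x_1,x_2,x_5]]$. A transposed Poisson 3-Lie algebra is a triple $(B,\cdot,[\cdot,\cdot,\cdot])$ where $(B,\cdot)$ is a commutative associative algebra (no unit assumed), $(B,[\cdot,\cdot,\cdot])$ is a 3-Lie algebra, and $3w\cdot[x,y,z]=[w\cdot x,y,z]+[x,w\cdot y,z]+[x,y,w\cdot z]$ for all $x,y,z,w\in B$. *)

theory Defs
  imports "Jordan_Normal_Form.Missing_VectorSpace" "HOL-Algebra.AbelCoset"
begin

text \<open>
  Vector spaces are carrier-based (locale \<^locale>\<open>vectorspace\<close>). The fields \<^const>\<open>mult\<close> and \<^const>\<open>one\<close>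
  that module records inherit from rings are never used; products and brackets are separate arguments.
\<close>

definition char_zero_ring :: "('a, 'm) ring_scheme \<Rightarrow> bool" where
  "char_zero_ring K \<longleftrightarrow> (\<forall>n::nat. 0 < n \<longrightarrow> [n] \<cdot>\<^bsub>K\<^esub> \<one>\<^bsub>K\<^esub> \<noteq> \<zero>\<^bsub>K\<^esub>)"

definition bilinear_op ::
  "('a, 'm) ring_scheme \<Rightarrow> ('a, 'v, 'n) module_scheme \<Rightarrow> ('v \<Rightarrow> 'v \<Rightarrow> 'v) \<Rightarrow> bool" where
  "bilinear_op K V f \<longleftrightarrow>
     (\<forall>x \<in> carrier V. (\<lambda>u. f u x) \<in> module_hom K V V \<and> (\<lambda>u. f x u) \<in> module_hom K V V)"

definition trilinear_op ::
  "('a, 'm) ring_scheme \<Rightarrow> ('a, 'v, 'n) module_scheme \<Rightarrow> ('v \<Rightarrow> 'v \<Rightarrow> 'v \<Rightarrow> 'v) \<Rightarrow> bool" where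
  "trilinear_op K V f \<longleftrightarrow>
     (\<forall>x \<in> carrier V. \<forall>y \<in> carrier V.
        (\<lambda>u. f u x y) \<in> module_hom K V V \<and>
        (\<lambda>u. f x u y) \<in> module_hom K V V \<and>
        (\<lambda>u. f x y u) \<in> module_hom K V V)"

locale comm_assoc_algebra = vectorspace K B for K and B +
  fixes m :: "'c \<Rightarrow> 'c \<Rightarrow> 'c"
  assumes m_bilinear: "bilinear_op K B m"
    and m_comm: "\<lbrakk>x \<in> carrier B; y \<in> carrier B\<rbrakk> \<Longrightarrow> m x y = m y x"
    and m_assoc: "\<lbrakk>x \<in> carrier B; y \<in> carrier B; z \<in> carrier B\<rbrakk> \<Longrightarrow> m (m x y) z = m x (m y z)"

text \<open>Skew-symmetry is required for the two adjacent transpositions, which generate all permutations.\<close>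

locale three_lie_algebra = vectorspace K B for K and B +
  fixes br :: "'c \<Rightarrow> 'c \<Rightarrow> 'c \<Rightarrow> 'c"
  assumes br_trilinear: "trilinear_op K B br"
    and br_skew12: "\<lbrakk>x \<in> carrier B; y \<in> carrier B; z \<in> carrier B\<rbrakk> \<Longrightarrow>
      br y x z = \<ominus>\<^bsub>B\<^esub> br x y z"
    and br_skew23: "\<lbrakk>x \<in> carrier B; y \<in> carrier B; z \<in> carrier B\<rbrakk> \<Longrightarrow>
      br x z y = \<ominus>\<^bsub>B\<^esub> br x y z"
    and br_fundamental:
      "\<lbrakk>x1 \<in> carrier B; x2 \<in> carrier B; x3 \<in> carrier B; x4 \<in> carrier B; x5 \<in> carrier B\<rbrakk> \<Longrightarrow>
      br x1 x2 (br x3 x4 x5) =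
        br (br x1 x2 x3) x4 x5 \<oplus>\<^bsub>B\<^esub> br x3 (br x1 x2 x4) x5 \<oplus>\<^bsub>B\<^esub> br x3 x4 (br x1 x2 x5)"

locale transposed_poisson_3_lie_algebra =
  comm_assoc_algebra K B m + three_lie_algebra K B br for K and B and m and br +
  assumes transposed_leibniz:
    "\<lbrakk>w \<in> carrier B; x \<in> carrier B; y \<in> carrier B; z \<in> carrier B\<rbrakk> \<Longrightarrow>
      [(3::nat)] \<cdot>\<^bsub>B\<^esub> m w (br x y z) =
        br (m w x) y z \<oplus>\<^bsub>B\<^esub> br x (m w y) z \<oplus>\<^bsub>B\<^esub> br x y (m w z)"

text \<open>
  The tensor product is the free vector space on \<open>carrier U \<times> carrier V\<close> modulo the span of the usual
  bilinearity relations. The carrier of the quotient consists of cosets.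
\<close>

definition free_space :: "('a, 'm) ring_scheme \<Rightarrow> 'x set \<Rightarrow> ('a, 'x \<Rightarrow> 'a) module" where
  "free_space K X =
     \<lparr>carrier = {f. f \<in> X \<rightarrow> carrier K \<and> (\<forall>x. x \<notin> X \<longrightarrow> f x = \<zero>\<^bsub>K\<^esub>) \<and> finite {x. f x \<noteq> \<zero>\<^bsub>K\<^esub>}},
      mult = undefined, one = undefined,
      zero = (\<lambda>x. \<zero>\<^bsub>K\<^esub>),
      add = (\<lambda>f g x. f x \<oplus>\<^bsub>K\<^esub> g x),
      smult = (\<lambda>a f x. a \<otimes>\<^bsub>K\<^esub> f x)\<rparr>"

definition free_gen :: "('a, 'm) ring_scheme \<Rightarrow> 'x \<Rightarrow> 'x \<Rightarrow> 'a" where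
  "free_gen K x = (\<lambda>z. if z = x then \<one>\<^bsub>K\<^esub> else \<zero>\<^bsub>K\<^esub>)"

definition quotient_space ::
  "('a, 'v, 'n) module_scheme \<Rightarrow> 'v set \<Rightarrow> ('a, 'v set) module" where
  "quotient_space F N =
     \<lparr>carrier = a_rcosets\<^bsub>F\<^esub> N,
      mult = undefined, one = undefined,
      zero = N,
      add = (\<lambda>P Q. P <+>\<^bsub>F\<^esub> Q),
      smult = (\<lambda>a P. \<Union>p \<in> P. N +>\<^bsub>F\<^esub> (a \<odot>\<^bsub>F\<^esub> p))\<rparr>"

definition tensor_relators ::
  "('a, 'm) ring_scheme \<Rightarrow> ('a, 'u, 'n) module_scheme \<Rightarrow> ('a, 'v, 'p) module_scheme \<Rightarrow>
   ('u \<times> 'v \<Rightarrow> 'a) set" where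
  "tensor_relators K U V =
     (let F = free_space K (carrier U \<times> carrier V); e = (\<lambda>u v. free_gen K (u, v)) in
      {e (u \<oplus>\<^bsub>U\<^esub> u') v \<ominus>\<^bsub>F\<^esub> (e u v \<oplus>\<^bsub>F\<^esub> e u' v) | u u' v.
         u \<in> carrier U \<and> u' \<in> carrier U \<and> v \<in> carrier V} \<union>
      {e u (v \<oplus>\<^bsub>V\<^esub> v') \<ominus>\<^bsub>F\<^esub> (e u v \<oplus>\<^bsub>F\<^esub> e u v') | u v v'.
         u \<in> carrier U \<and> v \<in> carrier V \<and> v' \<in> carrier V} \<union>
      {e (a \<odot>\<^bsub>U\<^esub> u) v \<ominus>\<^bsub>F\<^esub> a \<odot>\<^bsub>F\<^esub> e u v | a u v.
         a \<in> carrier K \<and> u \<in> carrier U \<and> v \<in> carrier V} \<union>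
      {e u (a \<odot>\<^bsub>V\<^esub> v) \<ominus>\<^bsub>F\<^esub> a \<odot>\<^bsub>F\<^esub> e u v | a u v.
         a \<in> carrier K \<and> u \<in> carrier U \<and> v \<in> carrier V})"

definition tensor_kernel ::
  "('a, 'm) ring_scheme \<Rightarrow> ('a, 'u, 'n) module_scheme \<Rightarrow> ('a, 'v, 'p) module_scheme \<Rightarrow>
   ('u \<times> 'v \<Rightarrow> 'a) set" where
  "tensor_kernel K U V =
     module.span K (free_space K (carrier U \<times> carrier V)) (tensor_relators K U V)"

definition tensor_space ::
  "('a, 'm) ring_scheme \<Rightarrow> ('a, 'u, 'n) module_scheme \<Rightarrow> ('a, 'v, 'p) module_scheme \<Rightarrow>
   ('a, ('u \<times> 'v \<Rightarrow> 'a) set) module" where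
  "tensor_space K U V =
     quotient_space (free_space K (carrier U \<times> carrier V)) (tensor_kernel K U V)"

definition pure_tensor ::
  "('a, 'm) ring_scheme \<Rightarrow> ('a, 'u, 'n) module_scheme \<Rightarrow> ('a, 'v, 'p) module_scheme \<Rightarrow>
   'u \<Rightarrow> 'v \<Rightarrow> ('u \<times> 'v \<Rightarrow> 'a) set" where
  "pure_tensor K U V u v =
     tensor_kernel K U V +>\<^bsub>free_space K (carrier U \<times> carrier V)\<^esub> free_gen K (u, v)"

text \<open>A linear map out of a tensor power is rendered as a multilinear map.\<close>

definition is_tensor_mult where
  "is_tensor_mult K B1 m1 B2 m2 \<mu> \<longleftrightarrow>
     bilinear_op K (tensor_space K B1 B2) \<mu> \<and>
     (\<forall>x1 \<in> carrier B1. \<forall>x2 \<in> carrier B1. \<forall>y1 \<in> carrier B2. \<forall>y2 \<in> carrier B2.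
        \<mu> (pure_tensor K B1 B2 x1 y1) (pure_tensor K B1 B2 x2 y2) =
          pure_tensor K B1 B2 (m1 x1 x2) (m2 y1 y2))"

definition is_tensor_bracket where
  "is_tensor_bracket K B1 br1 B2 m2 \<tau> \<longleftrightarrow>
     trilinear_op K (tensor_space K B1 B2) \<tau> \<and>
     (\<forall>x1 \<in> carrier B1. \<forall>x2 \<in> carrier B1. \<forall>x3 \<in> carrier B1.
      \<forall>y1 \<in> carrier B2. \<forall>y2 \<in> carrier B2. \<forall>y3 \<in> carrier B2.
        \<tau> (pure_tensor K B1 B2 x1 y1) (pure_tensor K B1 B2 x2 y2) (pure_tensor K B1 B2 x3 y3) =
          pure_tensor K B1 B2 (br1 x1 x2 x3) (m2 (m2 y1 y2) y3))"

end

theory Submission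
  imports Defs
begin

text \<open>
  The tensor product is additively generated by pure tensors and has the universal property for
  bilinear maps. Applying that property one tensor factor at a time, the other factors being
  parameters on which the lift depends linearly, extends the two formulas on pure tensors to a
  bilinear product and a trilinear bracket, uniquely. Every axiom is multilinear, so it is enough to
  check it on pure tensors; there all terms have the same second component, by commutativity and
  associativity of \<open>B\<^sub>2\<close>, and the first components satisfy the axiom in \<open>B\<^sub>1\<close>.
\<close>

text \<open>The delicate point is that lifts are obtained by choice, so nothing about how a chosen
  lift varies with its parameters is built in. Uniqueness supplies it: if a family of bilinear maps
  depends linearly on x, then the lift at x + y and the sum of the lifts at x and at y are linear
  maps with the same values on pure tensors, hence they are equal on the carrier. Pointwise sums and
  multiples of linear maps are recorded for such comparisons. The parameter may range over a factor
  or over the tensor product itself, so this one principle yields linearity in every slot that is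
  not lifted last. Two routes lead back to pure tensors. Identities in two or three arguments
  compare multilinear maps; the fundamental identity and the transposed Leibniz rule, with five and
  four arguments, use nested induction instead.\<close>

lemma module_homI:
  assumes "\<And>x. x \<in> carrier M \<Longrightarrow> f x \<in> carrier N"
    and "\<And>x y. x \<in> carrier M \<Longrightarrow> y \<in> carrier M \<Longrightarrow> f (x \<oplus>\<^bsub>M\<^esub> y) = f x \<oplus>\<^bsub>N\<^esub> f y"
    and "\<And>a x. a \<in> carrier R \<Longrightarrow> x \<in> carrier M \<Longrightarrow> f (a \<odot>\<^bsub>M\<^esub> x) = a \<odot>\<^bsub>N\<^esub> f x"
  shows "f \<in> module_hom R M N"
  using assms by (auto simp: module_hom_def Pi_iff)

lemma module_hom_mem:
  "f \<in> module_hom R M N \<Longrightarrow> x \<in> carrier M \<Longrightarrow> f x \<in> carrier N"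
  by (auto simp: module_hom_def)

lemma module_hom_compose:
  assumes "f \<in> module_hom R M N" and "g \<in> module_hom R N P"
  shows "(\<lambda>x. g (f x)) \<in> module_hom R M P"
  using assms by (auto simp: module_hom_def Pi_iff)

section \<open>Pointwise operations on linear maps\<close>

lemma (in module) module_hom_plus:
  assumes "f \<in> module_hom R P M" and "g \<in> module_hom R P M"
  shows "(\<lambda>x. f x \<oplus>\<^bsub>M\<^esub> g x) \<in> module_hom R P M"
proof (rule module_homI)
  fix x y assume "x \<in> carrier P" "y \<in> carrier P"
  then show "f (x \<oplus>\<^bsub>P\<^esub> y) \<oplus>\<^bsub>M\<^esub> g (x \<oplus>\<^bsub>P\<^esub> y) = (f x \<oplus>\<^bsub>M\<^esub> g x) \<oplus>\<^bsub>M\<^esub> (f y \<oplus>\<^bsub>M\<^esub> g y)"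
    using assms by (simp add: module_hom_add module_hom_mem M.a_ac)
qed (use assms in \<open>simp_all add: module_hom_mem module_hom_smult smult_r_distr\<close>)

lemma (in module) module_hom_uminus:
  assumes "f \<in> module_hom R P M"
  shows "(\<lambda>x. \<ominus>\<^bsub>M\<^esub> f x) \<in> module_hom R P M"
  by (rule module_homI)
    (use assms in \<open>simp_all add: module_hom_mem module_hom_add module_hom_smult smult_r_minus M.minus_add\<close>)

lemma (in module) module_hom_smult_fun:
  assumes "a \<in> carrier R" and "f \<in> module_hom R P M"
  shows "(\<lambda>x. a \<odot>\<^bsub>M\<^esub> f x) \<in> module_hom R P M"
  by (rule module_homI)
    (use assms in \<open>simp_all add: module_hom_mem module_hom_add module_hom_smult smult_r_distr
      R.m_comm flip: smult_assoc1\<close>)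

section \<open>Free modules\<close>

lemma (in cring) module_free_space: "module R (free_space R X)"
proof (rule module_criteria)
  show "\<forall>f\<in>carrier (free_space R X). \<exists>g\<in>carrier (free_space R X).
      f \<oplus>\<^bsub>free_space R X\<^esub> g = \<zero>\<^bsub>free_space R X\<^esub>"
  proof
    fix f assume f: "f \<in> carrier (free_space R X)"
    have fR: "f x \<in> carrier R" for x using f by (cases "x \<in> X") (auto simp: free_space_def)
    have "{x. \<ominus> f x \<noteq> \<zero>} \<subseteq> {x. f x \<noteq> \<zero>}" by auto
    then have "(\<lambda>x. \<ominus> f x) \<in> carrier (free_space R X)"
      using f fR by (auto simp: free_space_def intro: finite_subset)
    moreover have "f \<oplus>\<^bsub>free_space R X\<^esub> (\<lambda>x. \<ominus> f x) = \<zero>\<^bsub>free_space R X\<^esub>"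
      using fR by (auto simp: free_space_def r_neg)
    ultimately show "\<exists>g\<in>carrier (free_space R X).
      f \<oplus>\<^bsub>free_space R X\<^esub> g = \<zero>\<^bsub>free_space R X\<^esub>" by blast
  qed
next
  show "\<forall>f g. f \<in> carrier (free_space R X) \<and> g \<in> carrier (free_space R X) \<longrightarrow>
      f \<oplus>\<^bsub>free_space R X\<^esub> g \<in> carrier (free_space R X)"
  proof (intro allI impI)
    fix f g assume fg: "f \<in> carrier (free_space R X) \<and> g \<in> carrier (free_space R X)"
    have "{x. f x \<oplus> g x \<noteq> \<zero>} \<subseteq> {x. f x \<noteq> \<zero>} \<union> {x. g x \<noteq> \<zero>}" by auto
    then have "finite {x. f x \<oplus> g x \<noteq> \<zero>}"
      using fg by (auto simp: free_space_def intro: finite_subset)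
    then show "f \<oplus>\<^bsub>free_space R X\<^esub> g \<in> carrier (free_space R X)"
      using fg by (auto simp: free_space_def)
  qed
next
  show "\<forall>a f. a \<in> carrier R \<and> f \<in> carrier (free_space R X) \<longrightarrow>
      a \<odot>\<^bsub>free_space R X\<^esub> f \<in> carrier (free_space R X)"
  proof (intro allI impI)
    fix a f assume af: "a \<in> carrier R \<and> f \<in> carrier (free_space R X)"
    then have "{x. a \<otimes> f x \<noteq> \<zero>} \<subseteq> {x. f x \<noteq> \<zero>}" by auto
    then have "finite {x. a \<otimes> f x \<noteq> \<zero>}"
      using af by (auto simp: free_space_def intro: finite_subset)
    then show "a \<odot>\<^bsub>free_space R X\<^esub> f \<in> carrier (free_space R X)"
      using af by (auto simp: free_space_def)
  qed
next
  have R: "f x \<in> carrier R" if "f \<in> carrier (free_space R X)" for f x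
    using that by (cases "x \<in> X") (auto simp: free_space_def)
  have ops: "(f \<oplus>\<^bsub>free_space R X\<^esub> g) = (\<lambda>x. f x \<oplus> g x)" "(a \<odot>\<^bsub>free_space R X\<^esub> f) = (\<lambda>x. a \<otimes> f x)"
    "\<zero>\<^bsub>free_space R X\<^esub> = (\<lambda>x. \<zero>)" for f g a
    by (simp_all add: free_space_def)
  show "\<forall>f g. f \<in> carrier (free_space R X) \<and> g \<in> carrier (free_space R X) \<longrightarrow>
      f \<oplus>\<^bsub>free_space R X\<^esub> g = g \<oplus>\<^bsub>free_space R X\<^esub> f"
    using R by (simp add: ops a_comm)
  show "\<forall>f g h. f \<in> carrier (free_space R X) \<and> g \<in> carrier (free_space R X) \<and> h \<in> carrier (free_space R X) \<longrightarrow>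
      f \<oplus>\<^bsub>free_space R X\<^esub> g \<oplus>\<^bsub>free_space R X\<^esub> h = f \<oplus>\<^bsub>free_space R X\<^esub> (g \<oplus>\<^bsub>free_space R X\<^esub> h)"
    using R by (simp add: ops a_assoc)
  show "\<forall>f\<in>carrier (free_space R X). f \<oplus>\<^bsub>free_space R X\<^esub> \<zero>\<^bsub>free_space R X\<^esub> = f"
    using R by (simp add: ops)
  show "\<forall>a b f. a \<in> carrier R \<and> b \<in> carrier R \<and> f \<in> carrier (free_space R X) \<longrightarrow>
      a \<otimes> b \<odot>\<^bsub>free_space R X\<^esub> f = a \<odot>\<^bsub>free_space R X\<^esub> (b \<odot>\<^bsub>free_space R X\<^esub> f)"
    using R by (simp add: ops m_assoc)
  show "\<forall>f\<in>carrier (free_space R X). \<one> \<odot>\<^bsub>free_space R X\<^esub> f = f"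
    using R by (simp add: ops)
  show "\<forall>a b f. a \<in> carrier R \<and> b \<in> carrier R \<and> f \<in> carrier (free_space R X) \<longrightarrow>
      (a \<oplus> b) \<odot>\<^bsub>free_space R X\<^esub> f = a \<odot>\<^bsub>free_space R X\<^esub> f \<oplus>\<^bsub>free_space R X\<^esub> b \<odot>\<^bsub>free_space R X\<^esub> f"
    using R by (simp add: ops l_distr)
  show "\<forall>a f g. a \<in> carrier R \<and> f \<in> carrier (free_space R X) \<and> g \<in> carrier (free_space R X) \<longrightarrow>
      a \<odot>\<^bsub>free_space R X\<^esub> (f \<oplus>\<^bsub>free_space R X\<^esub> g) = a \<odot>\<^bsub>free_space R X\<^esub> f \<oplus>\<^bsub>free_space R X\<^esub> a \<odot>\<^bsub>free_space R X\<^esub> g"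
    using R by (simp add: ops r_distr)
  show "\<zero>\<^bsub>free_space R X\<^esub> \<in> carrier (free_space R X)" by (simp add: free_space_def)
  show "cring R" ..
qed

lemma (in cring) free_gen_closed: "x \<in> X \<Longrightarrow> free_gen R x \<in> carrier (free_space R X)"
  by (auto simp: free_space_def free_gen_def)

text \<open>Supports are finite, so every element is reached from zero by adding one scaled
  generator at a time; the induction runs over the support.\<close>

lemma (in cring) free_space_induct:
  assumes f: "f \<in> carrier (free_space R X)"
    and zero: "P \<zero>\<^bsub>free_space R X\<^esub>"
    and step: "\<And>f a x. f \<in> carrier (free_space R X) \<Longrightarrow> P f \<Longrightarrow> a \<in> carrier R \<Longrightarrow> x \<in> X \<Longrightarrow>
      P (f \<oplus>\<^bsub>free_space R X\<^esub> a \<odot>\<^bsub>free_space R X\<^esub> free_gen R x)"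
  shows "P f"
proof -
  have "finite {x. f x \<noteq> \<zero>}" using f by (simp add: free_space_def)
  then show ?thesis using f
  proof (induction "{x. f x \<noteq> \<zero>}" arbitrary: f rule: finite_induct)
    case empty
    then have "f = \<zero>\<^bsub>free_space R X\<^esub>" by (auto simp: free_space_def)
    then show ?case using zero by simp
  next
    case (insert x A)
    \<comment> \<open>Resetting the value at \<open>x\<close> removes exactly \<open>x\<close> from
      the support, and the removed part is \<open>f x\<close> times the generator at
      \<open>x\<close>.\<close>
    let ?g = "f(x := \<zero>)"
    have fR: "f z \<in> carrier R" for z using insert.prems by (cases "z \<in> X") (auto simp: free_space_def)
    have "f x \<noteq> \<zero>" using insert.hyps by blast
    then have x: "x \<in> X" using insert.prems by (auto simp: free_space_def)
    have A: "A = {z. ?g z \<noteq> \<zero>}" using insert.hyps by auto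
    have g: "?g \<in> carrier (free_space R X)"
      using insert.prems insert.hyps(1) A by (auto simp: free_space_def)
    have "f = ?g \<oplus>\<^bsub>free_space R X\<^esub> f x \<odot>\<^bsub>free_space R X\<^esub> free_gen R x"
      using fR by (auto simp: free_space_def free_gen_def)
    then show ?case using step[OF g insert.hyps(3)[OF A g] fR[of x] x] by metis
  qed
qed

lemma (in module) free_space_lift:
  assumes g: "g \<in> X \<rightarrow> carrier M"
  shows "\<exists>h \<in> module_hom R (free_space R X) M. \<forall>x \<in> X. h (free_gen R x) = g x"
proof -
  define h where "h f = (\<Oplus>\<^bsub>M\<^esub>x\<in>{x. f x \<noteq> \<zero>}. f x \<odot>\<^bsub>M\<^esub> g x)" for f
  have RM: "f x \<in> carrier R" "f x \<odot>\<^bsub>M\<^esub> g x \<in> carrier M"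
    if "f \<in> carrier (free_space R X)" "x \<in> X" for f x
    using that g by (force simp: free_space_def Pi_iff)+
  \<comment> \<open>The support of a sum may be smaller than the union of the supports. Terms
    outside the support vanish, so \<open>h\<close> may be computed over any finite superset, which
    gives additivity a common index set.\<close>
  have h_superset: "h f = (\<Oplus>\<^bsub>M\<^esub>x\<in>S. f x \<odot>\<^bsub>M\<^esub> g x)"
    if f: "f \<in> carrier (free_space R X)" and S: "finite S" "S \<subseteq> X" "{x. f x \<noteq> \<zero>} \<subseteq> S" for f S
    unfolding h_def
  proof (rule M.add.finprod_mono_neutral_cong_left)
    fix x assume "x \<in> S - {x. f x \<noteq> \<zero>}"
    then show "f x \<odot>\<^bsub>M\<^esub> g x = \<zero>\<^bsub>M\<^esub>" using S g by (auto simp: Pi_iff)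
  qed (use S RM[OF f] in auto)
  have supp: "finite {x. f x \<noteq> \<zero>}" "{x. f x \<noteq> \<zero>} \<subseteq> X" if "f \<in> carrier (free_space R X)" for f
    using that by (auto simp: free_space_def)
  interpret F: module R "free_space R X" by (rule R.module_free_space)
  have "h \<in> module_hom R (free_space R X) M"
  proof (rule module_homI)
    fix f assume f: "f \<in> carrier (free_space R X)"
    show "h f \<in> carrier M"
      unfolding h_def using supp[OF f] RM[OF f] by (intro M.finsum_closed) auto
  next
    fix e f assume e: "e \<in> carrier (free_space R X)" and f: "f \<in> carrier (free_space R X)"
    let ?S = "{x. e x \<noteq> \<zero>} \<union> {x. f x \<noteq> \<zero>}"
    have S: "finite ?S" "?S \<subseteq> X" using supp e f by auto
    have ef: "e \<oplus>\<^bsub>free_space R X\<^esub> f = (\<lambda>x. e x \<oplus> f x)" by (simp add: free_space_def)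
    have "h (e \<oplus>\<^bsub>free_space R X\<^esub> f) = (\<Oplus>\<^bsub>M\<^esub>x\<in>?S. (e x \<oplus> f x) \<odot>\<^bsub>M\<^esub> g x)"
      by (subst h_superset[OF F.a_closed[OF e f] S]) (auto simp: ef)
    also have "\<dots> = (\<Oplus>\<^bsub>M\<^esub>x\<in>?S. e x \<odot>\<^bsub>M\<^esub> g x \<oplus>\<^bsub>M\<^esub> f x \<odot>\<^bsub>M\<^esub> g x)"
      using S RM[OF e] RM[OF f] g by (intro M.finsum_cong') (auto intro!: smult_l_distr)
    also have "\<dots> = (\<Oplus>\<^bsub>M\<^esub>x\<in>?S. e x \<odot>\<^bsub>M\<^esub> g x) \<oplus>\<^bsub>M\<^esub> (\<Oplus>\<^bsub>M\<^esub>x\<in>?S. f x \<odot>\<^bsub>M\<^esub> g x)"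
      using S RM[OF e] RM[OF f] by (intro M.finsum_addf) auto
    also have "\<dots> = h e \<oplus>\<^bsub>M\<^esub> h f"
      using h_superset[OF e S] h_superset[OF f S] by simp
    finally show "h (e \<oplus>\<^bsub>free_space R X\<^esub> f) = h e \<oplus>\<^bsub>M\<^esub> h f" .
  next
    fix a f assume a: "a \<in> carrier R" and f: "f \<in> carrier (free_space R X)"
    let ?S = "{x. f x \<noteq> \<zero>}"
    have af: "a \<odot>\<^bsub>free_space R X\<^esub> f = (\<lambda>x. a \<otimes> f x)" by (simp add: free_space_def)
    have "h (a \<odot>\<^bsub>free_space R X\<^esub> f) = (\<Oplus>\<^bsub>M\<^esub>x\<in>?S. (a \<otimes> f x) \<odot>\<^bsub>M\<^esub> g x)"
      by (subst h_superset[OF F.smult_closed[OF a f] supp[OF f]]) (use a in \<open>auto simp: af\<close>)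
    also have "\<dots> = (\<Oplus>\<^bsub>M\<^esub>x\<in>?S. a \<odot>\<^bsub>M\<^esub> (f x \<odot>\<^bsub>M\<^esub> g x))"
      using supp[OF f] RM[OF f] a g by (intro M.finsum_cong') (auto intro!: smult_assoc1)
    also have "\<dots> = a \<odot>\<^bsub>M\<^esub> h f"
      unfolding h_def using supp[OF f] RM[OF f] a by (intro finsum_smult_ldistr[symmetric]) auto
    finally show "h (a \<odot>\<^bsub>free_space R X\<^esub> f) = a \<odot>\<^bsub>M\<^esub> h f" .
  qed
  moreover have "h (free_gen R x) = g x" if x: "x \<in> X" for x
  proof -
    \<comment> \<open>The singleton is a superset of the support even when
      \<open>\<one> = \<zero>\<close>, where the support is empty.\<close>
    have "h (free_gen R x) = (\<Oplus>\<^bsub>M\<^esub>z\<in>{x}. free_gen R x z \<odot>\<^bsub>M\<^esub> g z)"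
      by (rule h_superset[OF R.free_gen_closed[OF x]]) (use x in \<open>auto simp: free_gen_def split: if_splits\<close>)
    also have "\<dots> = g x" using x g by (simp add: free_gen_def Pi_iff)
    finally show ?thesis .
  qed
  ultimately show ?thesis by blast
qed

section \<open>Quotient modules\<close>

context module
begin

text \<open>Gives access to the calculus of additive cosets. Closure under negation comes from
  scalar multiplication by \<open>\<ominus> \<one>\<close>.\<close>

lemma abelian_subgroup_submodule:
  assumes "submodule R N M"
  shows "abelian_subgroup N M"
proof -
  interpret N: submodule R N M by fact
  have "\<ominus>\<^bsub>M\<^esub> x \<in> N" if "x \<in> N" for x
    using that N.smult_closed[of "\<ominus> \<one>" x] smult_minus_1[of x] N.subset by (metis R.add.inv_closed R.one_closed subsetD)
  then have "additive_subgroup N M"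
    by (intro additive_subgroup.intro M.add.subgroupI) (use N.subset N.zero_closed in \<open>auto simp: a_inv_def simp del: N.zero_closed\<close>)
  then show ?thesis by (intro abelian_subgroupI3 M.abelian_group_axioms)
qed

lemma quotient_carrier:
  "carrier (quotient_space M N) = (\<lambda>x. N +>\<^bsub>M\<^esub> x) ` carrier M"
  by (auto simp: quotient_space_def A_RCOSETS_def' a_r_coset_def')

lemma quotient_add:
  assumes "submodule R N M" "x \<in> carrier M" "y \<in> carrier M"
  shows "(N +>\<^bsub>M\<^esub> x) \<oplus>\<^bsub>quotient_space M N\<^esub> (N +>\<^bsub>M\<^esub> y) = N +>\<^bsub>M\<^esub> (x \<oplus>\<^bsub>M\<^esub> y)"
  using abelian_subgroup.a_rcos_sum[OF abelian_subgroup_submodule] assms by (simp add: quotient_space_def)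

lemma quotient_zero:
  assumes "submodule R N M"
  shows "\<zero>\<^bsub>quotient_space M N\<^esub> = N +>\<^bsub>M\<^esub> \<zero>\<^bsub>M\<^esub>"
  using abelian_subgroup.a_rcos_const[OF abelian_subgroup_submodule[OF assms]] submodule.zero_closed[OF assms]
  by (simp add: quotient_space_def)

text \<open>Scalar multiplication on the quotient is a union over all representatives. Two
  representatives differ by an element of \<open>N\<close>, and \<open>N\<close> absorbs scalars, so
  all members of the union are the same coset; the union is not empty because \<open>x\<close> lies
  in its own coset.\<close>

lemma quotient_smult:
  assumes N: "submodule R N M" and a: "a \<in> carrier R" and x: "x \<in> carrier M"
  shows "a \<odot>\<^bsub>quotient_space M N\<^esub> (N +>\<^bsub>M\<^esub> x) = N +>\<^bsub>M\<^esub> (a \<odot>\<^bsub>M\<^esub> x)"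
proof -
  interpret N: submodule R N M by fact
  interpret A: abelian_subgroup N M by (rule abelian_subgroup_submodule[OF N])
  have "N +>\<^bsub>M\<^esub> (a \<odot>\<^bsub>M\<^esub> p) = N +>\<^bsub>M\<^esub> (a \<odot>\<^bsub>M\<^esub> x)" if "p \<in> N +>\<^bsub>M\<^esub> x" for p
  proof -
    from that obtain n where n: "n \<in> N" "p = n \<oplus>\<^bsub>M\<^esub> x" by (auto simp: a_r_coset_def')
    then have "a \<odot>\<^bsub>M\<^esub> p = a \<odot>\<^bsub>M\<^esub> n \<oplus>\<^bsub>M\<^esub> a \<odot>\<^bsub>M\<^esub> x"
      using a x N.subset smult_r_distr by auto
    then have "a \<odot>\<^bsub>M\<^esub> p \<in> N +>\<^bsub>M\<^esub> (a \<odot>\<^bsub>M\<^esub> x)"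
      using n a by (auto simp: a_r_coset_def')
    then show ?thesis using A.a_repr_independence'[of "a \<odot>\<^bsub>M\<^esub> p"] a x by simp
  qed
  then have "(\<Union>p\<in>N +>\<^bsub>M\<^esub> x. N +>\<^bsub>M\<^esub> (a \<odot>\<^bsub>M\<^esub> p)) = (\<Union>p\<in>N +>\<^bsub>M\<^esub> x. N +>\<^bsub>M\<^esub> (a \<odot>\<^bsub>M\<^esub> x))"
    by (intro SUP_cong refl)
  also have "\<dots> = N +>\<^bsub>M\<^esub> (a \<odot>\<^bsub>M\<^esub> x)" using A.a_rcos_self[OF x] by blast
  finally show ?thesis by (simp add: quotient_space_def)
qed

lemma module_quotient_space:
  assumes N: "submodule R N M"
  shows "module R (quotient_space M N)"
proof (rule module_criteria)
  show "\<forall>P\<in>carrier (quotient_space M N). \<exists>Q\<in>carrier (quotient_space M N).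
      P \<oplus>\<^bsub>quotient_space M N\<^esub> Q = \<zero>\<^bsub>quotient_space M N\<^esub>"
  proof
    fix P assume "P \<in> carrier (quotient_space M N)"
    then obtain x where x: "x \<in> carrier M" "P = N +>\<^bsub>M\<^esub> x" by (auto simp: quotient_carrier)
    then have "P \<oplus>\<^bsub>quotient_space M N\<^esub> (N +>\<^bsub>M\<^esub> (\<ominus>\<^bsub>M\<^esub> x)) = \<zero>\<^bsub>quotient_space M N\<^esub>"
      by (simp add: quotient_add[OF N] quotient_zero[OF N] M.r_neg)
    then show "\<exists>Q\<in>carrier (quotient_space M N).
      P \<oplus>\<^bsub>quotient_space M N\<^esub> Q = \<zero>\<^bsub>quotient_space M N\<^esub>"
      using x by (auto simp: quotient_carrier)
  qed
next
  note ops = quotient_carrier quotient_add[OF N] quotient_zero[OF N] quotient_smult[OF N]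
  let ?Q = "quotient_space M N"
  show "\<zero>\<^bsub>?Q\<^esub> \<in> carrier ?Q" by (simp add: ops)
  show "\<forall>P Q. P \<in> carrier ?Q \<and> Q \<in> carrier ?Q \<longrightarrow> P \<oplus>\<^bsub>?Q\<^esub> Q \<in> carrier ?Q" by (auto simp: ops)
  show "\<forall>a P. a \<in> carrier R \<and> P \<in> carrier ?Q \<longrightarrow> a \<odot>\<^bsub>?Q\<^esub> P \<in> carrier ?Q" by (auto simp: ops)
  show "\<forall>P Q. P \<in> carrier ?Q \<and> Q \<in> carrier ?Q \<longrightarrow> P \<oplus>\<^bsub>?Q\<^esub> Q = Q \<oplus>\<^bsub>?Q\<^esub> P"
    by (auto simp: ops M.a_comm)
  show "\<forall>P Q S. P \<in> carrier ?Q \<and> Q \<in> carrier ?Q \<and> S \<in> carrier ?Q \<longrightarrow>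
      P \<oplus>\<^bsub>?Q\<^esub> Q \<oplus>\<^bsub>?Q\<^esub> S = P \<oplus>\<^bsub>?Q\<^esub> (Q \<oplus>\<^bsub>?Q\<^esub> S)"
    by (auto simp: ops M.a_assoc)
  show "\<forall>P\<in>carrier ?Q. P \<oplus>\<^bsub>?Q\<^esub> \<zero>\<^bsub>?Q\<^esub> = P" by (auto simp: ops)
  show "\<forall>a b P. a \<in> carrier R \<and> b \<in> carrier R \<and> P \<in> carrier ?Q \<longrightarrow>
      a \<otimes> b \<odot>\<^bsub>?Q\<^esub> P = a \<odot>\<^bsub>?Q\<^esub> (b \<odot>\<^bsub>?Q\<^esub> P)"
    by (auto simp: ops smult_assoc1)
  show "\<forall>P\<in>carrier ?Q. \<one> \<odot>\<^bsub>?Q\<^esub> P = P" by (auto simp: ops)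
  show "\<forall>a b P. a \<in> carrier R \<and> b \<in> carrier R \<and> P \<in> carrier ?Q \<longrightarrow>
      (a \<oplus> b) \<odot>\<^bsub>?Q\<^esub> P = a \<odot>\<^bsub>?Q\<^esub> P \<oplus>\<^bsub>?Q\<^esub> b \<odot>\<^bsub>?Q\<^esub> P"
    by (auto simp: ops smult_l_distr)
  show "\<forall>a P Q. a \<in> carrier R \<and> P \<in> carrier ?Q \<and> Q \<in> carrier ?Q \<longrightarrow>
      a \<odot>\<^bsub>?Q\<^esub> (P \<oplus>\<^bsub>?Q\<^esub> Q) = a \<odot>\<^bsub>?Q\<^esub> P \<oplus>\<^bsub>?Q\<^esub> a \<odot>\<^bsub>?Q\<^esub> Q"
    by (auto simp: ops smult_r_distr)
  show "cring R" ..
qed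

lemma quotient_hom:
  assumes N: "submodule R N M"
  shows "(\<lambda>x. N +>\<^bsub>M\<^esub> x) \<in> module_hom R M (quotient_space M N)"
  by (rule module_homI) (auto simp: quotient_carrier quotient_add[OF N] quotient_smult[OF N])

end

lemma (in mod_hom) quotient_lift:
  assumes S: "submodule R S M" and ker: "\<And>x. x \<in> S \<Longrightarrow> f x = \<zero>\<^bsub>N\<^esub>"
  shows "\<exists>h \<in> module_hom R (quotient_space M S) N. \<forall>x \<in> carrier M. h (S +>\<^bsub>M\<^esub> x) = f x"
proof -
  interpret A: abelian_subgroup S M by (rule M.abelian_subgroup_submodule[OF S])
  \<comment> \<open>Any representative serves: two of them differ by an element of \<open>S\<close>,
    where \<open>f\<close> vanishes.\<close>
  define h where "h P = f (SOME x. x \<in> P)" for P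
  have h: "h (S +>\<^bsub>M\<^esub> x) = f x" if x: "x \<in> carrier M" for x
  proof -
    have "(SOME y. y \<in> S +>\<^bsub>M\<^esub> x) \<in> S +>\<^bsub>M\<^esub> x" using A.a_rcos_self[OF x] by (rule someI)
    then obtain n where "n \<in> S" "(SOME y. y \<in> S +>\<^bsub>M\<^esub> x) = n \<oplus>\<^bsub>M\<^esub> x" by (auto simp: a_r_coset_def')
    then show ?thesis using x ker submodule.subset[OF S] by (simp add: h_def subset_iff)
  qed
  have "h \<in> module_hom R (quotient_space M S) N"
    by (rule module_homI)
      (auto simp: M.quotient_carrier M.quotient_add[OF S] M.quotient_smult[OF S] h)
  then show ?thesis using h by blast
qed

section \<open>The universal property of the tensor product\<close>

text \<open>Unlike in \<open>bilinear_op\<close>, the two sources and the target may be three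
  different spaces, as they are for \<open>pure_tensor\<close>.\<close>

definition bilinear_map where
  "bilinear_map K U V W g \<longleftrightarrow>
     (\<forall>v \<in> carrier V. (\<lambda>u. g u v) \<in> module_hom K U W) \<and>
     (\<forall>u \<in> carrier U. (\<lambda>v. g u v) \<in> module_hom K V W)"

lemma bilinear_mapI:
  assumes "\<And>v. v \<in> carrier V \<Longrightarrow> (\<lambda>u. g u v) \<in> module_hom K U W"
    and "\<And>u. u \<in> carrier U \<Longrightarrow> (\<lambda>v. g u v) \<in> module_hom K V W"
  shows "bilinear_map K U V W g"
  using assms by (simp add: bilinear_map_def)

lemma bilinear_map_homD:
  assumes "bilinear_map K U V W g"
  shows "v \<in> carrier V \<Longrightarrow> (\<lambda>u. g u v) \<in> module_hom K U W"
    and "u \<in> carrier U \<Longrightarrow> (\<lambda>v. g u v) \<in> module_hom K V W"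
  using assms by (simp_all add: bilinear_map_def)

lemma bilinear_map_mem:
  assumes "bilinear_map K U V W g" "u \<in> carrier U" "v \<in> carrier V"
  shows "g u v \<in> carrier W"
  using module_hom_mem[OF bilinear_map_homD(1)[OF assms(1,3)] assms(2)] .

locale tensor_modules = U: module K U + V: module K V for K and U and V
begin

abbreviation "F \<equiv> free_space K (carrier U \<times> carrier V)"
abbreviation "N \<equiv> tensor_kernel K U V"
abbreviation "T \<equiv> tensor_space K U V"
abbreviation "p \<equiv> pure_tensor K U V"
abbreviation "e \<equiv> (\<lambda>u v. free_gen K (u, v))"

sublocale F: module K F
  by (rule U.R.module_free_space)

lemma gen_closed: "u \<in> carrier U \<Longrightarrow> v \<in> carrier V \<Longrightarrow> e u v \<in> carrier F"
  by (simp add: U.R.free_gen_closed)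

lemma relators_subset: "tensor_relators K U V \<subseteq> carrier F"
  unfolding tensor_relators_def Let_def by (auto simp: gen_closed)

lemma submodule_kernel: "submodule K N F"
  unfolding tensor_kernel_def by (rule F.span_is_submodule[OF relators_subset])

lemma relator_in_kernel: "x \<in> tensor_relators K U V \<Longrightarrow> x \<in> N"
  unfolding tensor_kernel_def using F.in_own_span[OF relators_subset] by blast

sublocale T: module K T
  unfolding tensor_space_def by (rule F.module_quotient_space[OF submodule_kernel])

lemma tensor_carrier: "carrier T = (\<lambda>f. N +>\<^bsub>F\<^esub> f) ` carrier F"
  unfolding tensor_space_def by (rule F.quotient_carrier)

lemma coset_hom: "(\<lambda>f. N +>\<^bsub>F\<^esub> f) \<in> module_hom K F T"
  unfolding tensor_space_def by (rule F.quotient_hom[OF submodule_kernel])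

lemma coset_eq:
  assumes "x \<in> carrier F" "y \<in> carrier F" "x \<ominus>\<^bsub>F\<^esub> y \<in> tensor_relators K U V"
  shows "N +>\<^bsub>F\<^esub> x = N +>\<^bsub>F\<^esub> y"
proof -
  interpret A: abelian_subgroup N F by (rule F.abelian_subgroup_submodule[OF submodule_kernel])
  have "x \<oplus>\<^bsub>F\<^esub> \<ominus>\<^bsub>F\<^esub> y \<in> N" using relator_in_kernel[OF assms(3)] by (simp add: a_minus_def)
  then have "x \<in> N +>\<^bsub>F\<^esub> y" using A.a_rcos_module_rev assms by blast
  then show ?thesis using A.a_repr_independence' assms by blast
qed

text \<open>The four families of relators are precisely the four laws of bilinearity, each written
  as a difference, so \<open>coset_eq\<close> turns each family into one law.\<close>

lemma bilinear_map_pure: "bilinear_map K U V T p"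
proof (rule bilinear_mapI; rule module_homI)
  show "p u v \<in> carrier T" if "u \<in> carrier U" "v \<in> carrier V" for u v
    using that by (auto simp: pure_tensor_def tensor_carrier gen_closed)
  then show "p u v \<in> carrier T" if "u \<in> carrier U" "v \<in> carrier V" for u v
    using that .
next
  fix v u u' assume prems: "u \<in> carrier U" "v \<in> carrier V" "u' \<in> carrier U"
  have "N +>\<^bsub>F\<^esub> e (u \<oplus>\<^bsub>U\<^esub> u') v = N +>\<^bsub>F\<^esub> (e u v \<oplus>\<^bsub>F\<^esub> e u' v)"
  proof (rule coset_eq)
    show "e (u \<oplus>\<^bsub>U\<^esub> u') v \<ominus>\<^bsub>F\<^esub> (e u v \<oplus>\<^bsub>F\<^esub> e u' v) \<in> tensor_relators K U V"
      using prems unfolding tensor_relators_def Let_def by blast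
  qed (use prems in \<open>simp_all add: gen_closed\<close>)
  also have "\<dots> = p u v \<oplus>\<^bsub>T\<^esub> p u' v"
    using prems
    by (simp add: pure_tensor_def gen_closed module_hom_add[OF coset_hom] module_hom_smult[OF coset_hom])
  finally show "p (u \<oplus>\<^bsub>U\<^esub> u') v = p u v \<oplus>\<^bsub>T\<^esub> p u' v" by (simp only: pure_tensor_def)
next
  fix v a u assume prems: "u \<in> carrier U" "v \<in> carrier V" "a \<in> carrier K"
  have "N +>\<^bsub>F\<^esub> e (a \<odot>\<^bsub>U\<^esub> u) v = N +>\<^bsub>F\<^esub> (a \<odot>\<^bsub>F\<^esub> e u v)"
  proof (rule coset_eq)
    show "e (a \<odot>\<^bsub>U\<^esub> u) v \<ominus>\<^bsub>F\<^esub> (a \<odot>\<^bsub>F\<^esub> e u v) \<in> tensor_relators K U V"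
      using prems unfolding tensor_relators_def Let_def by blast
  qed (use prems in \<open>simp_all add: gen_closed\<close>)
  also have "\<dots> = a \<odot>\<^bsub>T\<^esub> p u v"
    using prems
    by (simp add: pure_tensor_def gen_closed module_hom_add[OF coset_hom] module_hom_smult[OF coset_hom])
  finally show "p (a \<odot>\<^bsub>U\<^esub> u) v = a \<odot>\<^bsub>T\<^esub> p u v" by (simp only: pure_tensor_def)
next
  fix u v v' assume prems: "u \<in> carrier U" "v \<in> carrier V" "v' \<in> carrier V"
  have "N +>\<^bsub>F\<^esub> e u (v \<oplus>\<^bsub>V\<^esub> v') = N +>\<^bsub>F\<^esub> (e u v \<oplus>\<^bsub>F\<^esub> e u v')"
  proof (rule coset_eq)
    show "e u (v \<oplus>\<^bsub>V\<^esub> v') \<ominus>\<^bsub>F\<^esub> (e u v \<oplus>\<^bsub>F\<^esub> e u v') \<in> tensor_relators K U V"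
      using prems unfolding tensor_relators_def Let_def by blast
  qed (use prems in \<open>simp_all add: gen_closed\<close>)
  also have "\<dots> = p u v \<oplus>\<^bsub>T\<^esub> p u v'"
    using prems
    by (simp add: pure_tensor_def gen_closed module_hom_add[OF coset_hom] module_hom_smult[OF coset_hom])
  finally show "p u (v \<oplus>\<^bsub>V\<^esub> v') = p u v \<oplus>\<^bsub>T\<^esub> p u v'" by (simp only: pure_tensor_def)
next
  fix u a v assume prems: "u \<in> carrier U" "v \<in> carrier V" "a \<in> carrier K"
  have "N +>\<^bsub>F\<^esub> e u (a \<odot>\<^bsub>V\<^esub> v) = N +>\<^bsub>F\<^esub> (a \<odot>\<^bsub>F\<^esub> e u v)"
  proof (rule coset_eq)
    show "e u (a \<odot>\<^bsub>V\<^esub> v) \<ominus>\<^bsub>F\<^esub> (a \<odot>\<^bsub>F\<^esub> e u v) \<in> tensor_relators K U V"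
      using prems unfolding tensor_relators_def Let_def by blast
  qed (use prems in \<open>simp_all add: gen_closed\<close>)
  also have "\<dots> = a \<odot>\<^bsub>T\<^esub> p u v"
    using prems
    by (simp add: pure_tensor_def gen_closed module_hom_add[OF coset_hom] module_hom_smult[OF coset_hom])
  finally show "p u (a \<odot>\<^bsub>V\<^esub> v) = a \<odot>\<^bsub>T\<^esub> p u v" by (simp only: pure_tensor_def)
qed

lemma pure_closed: "u \<in> carrier U \<Longrightarrow> v \<in> carrier V \<Longrightarrow> p u v \<in> carrier T"
  by (rule bilinear_map_mem[OF bilinear_map_pure])

text \<open>There is no case for scalars because a scalar can be absorbed into the first factor of a
  pure tensor. Hence later inductions need only additivity of the operations.\<close>

lemma tensor_induct [consumes 1, case_names pure add]:
  assumes t: "t \<in> carrier T"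
    and pure: "\<And>u v. u \<in> carrier U \<Longrightarrow> v \<in> carrier V \<Longrightarrow> P (p u v)"
    and add: "\<And>s t. s \<in> carrier T \<Longrightarrow> t \<in> carrier T \<Longrightarrow> P s \<Longrightarrow> P t \<Longrightarrow> P (s \<oplus>\<^bsub>T\<^esub> t)"
  shows "P t"
proof -
  have smult_pure: "p (a \<odot>\<^bsub>U\<^esub> u) v = a \<odot>\<^bsub>T\<^esub> p u v"
    if "a \<in> carrier K" "u \<in> carrier U" "v \<in> carrier V" for a u v
    using module_hom_smult[OF bilinear_map_homD(1)[OF bilinear_map_pure that(3)] that(1,2)] .
  obtain f where f: "f \<in> carrier F" "t = N +>\<^bsub>F\<^esub> f" using t by (auto simp: tensor_carrier)
  from f(1) have "P (N +>\<^bsub>F\<^esub> f)"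
  proof (induction rule: U.R.free_space_induct[where P = "\<lambda>f. P (N +>\<^bsub>F\<^esub> f)", consumes 1])
    case 1
    have "N +>\<^bsub>F\<^esub> \<zero>\<^bsub>F\<^esub> = \<zero>\<^bsub>T\<^esub>"
      using F.quotient_zero[OF submodule_kernel] by (simp add: tensor_space_def)
    \<comment> \<open>Zero is itself a pure tensor: take the scalar zero in
      \<open>smult_pure\<close>.\<close>
    also have "\<dots> = p \<zero>\<^bsub>U\<^esub> \<zero>\<^bsub>V\<^esub>"
      using smult_pure[of "\<zero>\<^bsub>K\<^esub>" "\<zero>\<^bsub>U\<^esub>" "\<zero>\<^bsub>V\<^esub>"] pure_closed by simp
    finally show ?case using pure by simp
  next
    case (2 f a x)
    obtain u v where x: "x = (u, v)" "u \<in> carrier U" "v \<in> carrier V" using 2 by auto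
    have "N +>\<^bsub>F\<^esub> (f \<oplus>\<^bsub>F\<^esub> a \<odot>\<^bsub>F\<^esub> free_gen K x) = (N +>\<^bsub>F\<^esub> f) \<oplus>\<^bsub>T\<^esub> a \<odot>\<^bsub>T\<^esub> p u v"
      using 2 x gen_closed by (simp add: module_hom_add[OF coset_hom] module_hom_smult[OF coset_hom] pure_tensor_def)
    also have "\<dots> = (N +>\<^bsub>F\<^esub> f) \<oplus>\<^bsub>T\<^esub> p (a \<odot>\<^bsub>U\<^esub> u) v"
      using 2 x by (simp add: smult_pure)
    finally show ?case
      using add[of "N +>\<^bsub>F\<^esub> f" "p (a \<odot>\<^bsub>U\<^esub> u) v"] 2 x pure pure_closed by (auto simp: tensor_carrier)
  qed
  then show ?thesis using f by simp
qed

lemma module_hom_tensor_eqI: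
  assumes "f \<in> module_hom K T W" "g \<in> module_hom K T W"
    and "\<And>u v. u \<in> carrier U \<Longrightarrow> v \<in> carrier V \<Longrightarrow> f (p u v) = g (p u v)"
    and "t \<in> carrier T"
  shows "f t = g t"
  using assms(4)
  by (induction rule: tensor_induct) (simp_all add: assms(3) module_hom_add[OF assms(1)] module_hom_add[OF assms(2)])

text \<open>The linear extension of \<open>g\<close> to the free module kills every relator because
  \<open>g\<close> is bilinear. Its kernel is a submodule, so it contains the span of the relators,
  and the extension descends to the quotient.\<close>

lemma tensor_lift_exists:
  assumes W: "module K W" and g: "bilinear_map K U V W g"
  shows "\<exists>h \<in> module_hom K T W. \<forall>u \<in> carrier U. \<forall>v \<in> carrier V. h (p u v) = g u v"
proof -
  interpret W: module K W by fact
  have "(\<lambda>x. g (fst x) (snd x)) \<in> carrier U \<times> carrier V \<rightarrow> carrier W"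
    using bilinear_map_mem[OF g] by auto
  from W.free_space_lift[OF this] obtain f where f: "f \<in> module_hom K F W"
    and fe: "\<And>u v. u \<in> carrier U \<Longrightarrow> v \<in> carrier V \<Longrightarrow> f (e u v) = g u v"
    by auto
  interpret f: mod_hom K F W f by unfold_locales (rule f)
  note g_lin = bilinear_map_homD[OF g, THEN module_hom_add] bilinear_map_homD[OF g, THEN module_hom_smult]
  have "tensor_relators K U V \<subseteq> f.ker"
    unfolding tensor_relators_def Let_def f.ker_def
    by (auto simp: gen_closed fe g_lin bilinear_map_mem[OF g])
  then have "N \<subseteq> f.ker"
    unfolding tensor_kernel_def by (rule F.span_is_subset[OF _ f.ker_is_submodule])
  then have "\<exists>h \<in> module_hom K T W. \<forall>x \<in> carrier F. h (N +>\<^bsub>F\<^esub> x) = f x"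
    unfolding tensor_space_def by (intro f.quotient_lift submodule_kernel) (auto simp: f.ker_def)
  then obtain h where h: "h \<in> module_hom K T W" "\<And>x. x \<in> carrier F \<Longrightarrow> h (N +>\<^bsub>F\<^esub> x) = f x"
    by blast
  show ?thesis
    by (rule bexI[OF _ h(1)]) (simp add: pure_tensor_def h(2) gen_closed fe)
qed

text \<open>Lifting has to be a function of \<open>g\<close> in order to be iterated. For bilinear
  \<open>g\<close> into a module, the choice is free only outside the carrier of \<open>T\<close>,
  by \<open>module_hom_tensor_eqI\<close>.\<close>

definition tensor_lift where
  "tensor_lift W g = (SOME h. h \<in> module_hom K T W \<and>
     (\<forall>u \<in> carrier U. \<forall>v \<in> carrier V. h (p u v) = g u v))"

lemma
  assumes "module K W" and "bilinear_map K U V W g"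
  shows tensor_lift_hom: "tensor_lift W g \<in> module_hom K T W"
    and tensor_lift_pure: "u \<in> carrier U \<Longrightarrow> v \<in> carrier V \<Longrightarrow> tensor_lift W g (p u v) = g u v"
proof -
  have "\<exists>h. h \<in> module_hom K T W \<and> (\<forall>u \<in> carrier U. \<forall>v \<in> carrier V. h (p u v) = g u v)"
    using tensor_lift_exists[OF assms] by blast
  from someI_ex[OF this]
  show "tensor_lift W g \<in> module_hom K T W"
    and "u \<in> carrier U \<Longrightarrow> v \<in> carrier V \<Longrightarrow> tensor_lift W g (p u v) = g u v"
    unfolding tensor_lift_def by blast+
qed

text \<open>The choice behind \<open>tensor_lift\<close> is made separately for each
  \<open>x\<close>. For fixed parameters, however, both sides of each linearity law are linear in
  \<open>t\<close>, and on pure tensors they reduce to linearity of \<open>g\<close> in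
  \<open>x\<close>.\<close>

lemma tensor_lift_param_hom:
  assumes W: "module K W"
    and P: "module K P"
    and bilinear: "\<And>x. x \<in> carrier P \<Longrightarrow> bilinear_map K U V W (g x)"
    and hom: "\<And>u v. u \<in> carrier U \<Longrightarrow> v \<in> carrier V \<Longrightarrow> (\<lambda>x. g x u v) \<in> module_hom K P W"
    and t: "t \<in> carrier T"
  shows "(\<lambda>x. tensor_lift W (g x) t) \<in> module_hom K P W"
proof (rule module_homI)
  interpret W: module K W by fact
  interpret P: module K P by fact
  note lift = tensor_lift_hom[OF W bilinear] tensor_lift_pure[OF W bilinear]
  show "tensor_lift W (g x) t \<in> carrier W" if "x \<in> carrier P" for x
    by (rule module_hom_mem[OF lift(1)[OF that] t])
  show "tensor_lift W (g (x \<oplus>\<^bsub>P\<^esub> y)) t = tensor_lift W (g x) t \<oplus>\<^bsub>W\<^esub> tensor_lift W (g y) t"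
    if x: "x \<in> carrier P" and y: "y \<in> carrier P" for x y
    by (rule module_hom_tensor_eqI[OF _ W.module_hom_plus _ t])
      (use x y in \<open>simp_all add: lift module_hom_add[OF hom]\<close>)
  show "tensor_lift W (g (a \<odot>\<^bsub>P\<^esub> x)) t = a \<odot>\<^bsub>W\<^esub> tensor_lift W (g x) t"
    if a: "a \<in> carrier K" and x: "x \<in> carrier P" for a x
    by (rule module_hom_tensor_eqI[OF _ W.module_hom_smult_fun _ t])
      (use a x in \<open>simp_all add: lift module_hom_smult[OF hom]\<close>)
qed

end

text \<open>Applied to the product and bracket formulas: once all pairs but one are fixed, each
  formula is the pure tensor map preceded by a linear map in each factor.\<close>

lemma bilinear_map_compose:
  assumes "bilinear_map K U V W b" and "f \<in> module_hom K U' U" and "h \<in> module_hom K V' V"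
  shows "bilinear_map K U' V' W (\<lambda>u v. b (f u) (h v))"
  using assms
  by (intro bilinear_mapI module_hom_compose[OF assms(2)] module_hom_compose[OF assms(3)])
    (auto intro: bilinear_map_homD module_hom_mem)

lemma bilinear_op_iff: "bilinear_op K V f \<longleftrightarrow> bilinear_map K V V V f"
  by (auto simp: bilinear_op_def bilinear_map_def)

section \<open>Iterated lifts to two and three tensor factors\<close>

context tensor_modules
begin

text \<open>This amounts to linearity in each of the four arguments, grouped into pairs because one
  lift consumes one pair.\<close>

definition separately_bilinear where
  "separately_bilinear W g \<longleftrightarrow>
     (\<forall>u \<in> carrier U. \<forall>v \<in> carrier V.
        bilinear_map K U V W (\<lambda>u' v'. g u' v' u v) \<and> bilinear_map K U V W (\<lambda>u' v'. g u v u' v'))"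

definition tensor_lift2 where
  "tensor_lift2 W g s t = tensor_lift W (\<lambda>u' v'. tensor_lift W (\<lambda>u v. g u v u' v') s) t"

definition tensor_lift3 where
  "tensor_lift3 W g r s t =
     tensor_lift W (\<lambda>u'' v''. tensor_lift2 W (\<lambda>u v u' v'. g u v u' v' u'' v'') r s) t"

lemma separately_bilinearD:
  assumes "separately_bilinear W g" "u \<in> carrier U" "v \<in> carrier V"
  shows "bilinear_map K U V W (\<lambda>u' v'. g u' v' u v)"
    and "bilinear_map K U V W (\<lambda>u' v'. g u v u' v')"
  using assms by (auto simp: separately_bilinear_def)

text \<open>Makes the outer lift in \<open>tensor_lift2\<close> legitimate: the remaining pair acts
  as a parameter of the inner lift, ranging over \<open>U\<close> in one component and over
  \<open>V\<close> in the other.\<close>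

lemma bilinear_map_tensor_lift:
  assumes W: "module K W" and g: "separately_bilinear W g" and s: "s \<in> carrier T"
  shows "bilinear_map K U V W (\<lambda>u' v'. tensor_lift W (\<lambda>u v. g u v u' v') s)"
proof (rule bilinear_mapI)
  note g1 = separately_bilinearD(1)[OF g] and g2 = separately_bilinearD(2)[OF g]
  show "(\<lambda>u'. tensor_lift W (\<lambda>u v. g u v u' v') s) \<in> module_hom K U W" if v': "v' \<in> carrier V" for v'
    by (rule tensor_lift_param_hom[OF W U.module_axioms g1[OF _ v'] bilinear_map_homD(1)[OF g2 v'] s])
  show "(\<lambda>v'. tensor_lift W (\<lambda>u v. g u v u' v') s) \<in> module_hom K V W" if u': "u' \<in> carrier U" for u'
    by (rule tensor_lift_param_hom[OF W V.module_axioms g1[OF u'] bilinear_map_homD(2)[OF g2 u'] s])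
qed

text \<open>Linearity in the second argument holds because the outer map is a lift. In the first
  argument the tensor product itself is the parameter space: the inner lift is linear in it, and the
  outer lift preserves this.\<close>

lemma bilinear_map_tensor_lift2:
  assumes W: "module K W" and g: "separately_bilinear W g"
  shows "bilinear_map K T T W (tensor_lift2 W g)"
  unfolding tensor_lift2_def
proof (rule bilinear_mapI)
  show "(\<lambda>t. tensor_lift W (\<lambda>u' v'. tensor_lift W (\<lambda>u v. g u v u' v') s) t) \<in> module_hom K T W"
    if "s \<in> carrier T" for s
    by (rule tensor_lift_hom[OF W bilinear_map_tensor_lift[OF W g that]])
  show "(\<lambda>s. tensor_lift W (\<lambda>u' v'. tensor_lift W (\<lambda>u v. g u v u' v') s) t) \<in> module_hom K T W"
    if "t \<in> carrier T" for t
    by (rule tensor_lift_param_hom[OF W T.module_axioms bilinear_map_tensor_lift[OF W g]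
          tensor_lift_hom[OF W separately_bilinearD(1)[OF g]] that])
qed

lemma tensor_lift2_pure:
  assumes "module K W" and "separately_bilinear W g"
    and "u \<in> carrier U" "v \<in> carrier V" "u' \<in> carrier U" "v' \<in> carrier V"
  shows "tensor_lift2 W g (p u v) (p u' v') = g u v u' v'"
  using assms
  by (simp add: tensor_lift2_def tensor_lift_pure bilinear_map_tensor_lift pure_closed separately_bilinearD)

lemma tensor_lift2_param_hom:
  assumes W: "module K W" and P: "module K P"
    and g: "\<And>x. x \<in> carrier P \<Longrightarrow> separately_bilinear W (g x)"
    and hom: "\<And>u v u' v'. u \<in> carrier U \<Longrightarrow> v \<in> carrier V \<Longrightarrow> u' \<in> carrier U \<Longrightarrow> v' \<in> carrier V \<Longrightarrow>
      (\<lambda>x. g x u v u' v') \<in> module_hom K P W"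
    and s: "s \<in> carrier T" and t: "t \<in> carrier T"
  shows "(\<lambda>x. tensor_lift2 W (g x) s t) \<in> module_hom K P W"
  unfolding tensor_lift2_def
  by (rule tensor_lift_param_hom[OF W P bilinear_map_tensor_lift[OF W g s] _ t],
      assumption, rule tensor_lift_param_hom[OF W P separately_bilinearD(1)[OF g] hom s])

lemma
  assumes W: "module K W"
    and g12: "\<And>u v. u \<in> carrier U \<Longrightarrow> v \<in> carrier V \<Longrightarrow> separately_bilinear W (\<lambda>u1 v1 u2 v2. g u1 v1 u2 v2 u v)"
    and g3: "\<And>u v u' v'. u \<in> carrier U \<Longrightarrow> v \<in> carrier V \<Longrightarrow> u' \<in> carrier U \<Longrightarrow> v' \<in> carrier V \<Longrightarrow>
      bilinear_map K U V W (\<lambda>u3 v3. g u v u' v' u3 v3)"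
  shows tensor_lift3_hom:
      "s \<in> carrier T \<Longrightarrow> t \<in> carrier T \<Longrightarrow> (\<lambda>r. tensor_lift3 W g r s t) \<in> module_hom K T W"
      "r \<in> carrier T \<Longrightarrow> t \<in> carrier T \<Longrightarrow> (\<lambda>s. tensor_lift3 W g r s t) \<in> module_hom K T W"
      "r \<in> carrier T \<Longrightarrow> s \<in> carrier T \<Longrightarrow> (\<lambda>t. tensor_lift3 W g r s t) \<in> module_hom K T W"
    and tensor_lift3_pure:
      "u1 \<in> carrier U \<Longrightarrow> v1 \<in> carrier V \<Longrightarrow> u2 \<in> carrier U \<Longrightarrow> v2 \<in> carrier V \<Longrightarrow>
       u3 \<in> carrier U \<Longrightarrow> v3 \<in> carrier V \<Longrightarrow>
       tensor_lift3 W g (p u1 v1) (p u2 v2) (p u3 v3) = g u1 v1 u2 v2 u3 v3"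
proof -
  \<comment> \<open>As a function of the third pair, the double lift is bilinear, so it can be
    lifted once more. Linearity in \<open>r\<close> and \<open>s\<close> then passes through this
    last lift with \<open>T\<close> as parameter space, and linearity in \<open>t\<close> is that of
    a lift.\<close>
  have lift2: "bilinear_map K U V W (\<lambda>u3 v3. tensor_lift2 W (\<lambda>u1 v1 u2 v2. g u1 v1 u2 v2 u3 v3) r s)"
    if r: "r \<in> carrier T" and s: "s \<in> carrier T" for r s
  proof (rule bilinear_mapI)
    show "(\<lambda>u3. tensor_lift2 W (\<lambda>u1 v1 u2 v2. g u1 v1 u2 v2 u3 v3) r s) \<in> module_hom K U W"
      if v3: "v3 \<in> carrier V" for v3
      by (rule tensor_lift2_param_hom[OF W U.module_axioms g12[OF _ v3] bilinear_map_homD(1)[OF g3 v3] r s])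
    show "(\<lambda>v3. tensor_lift2 W (\<lambda>u1 v1 u2 v2. g u1 v1 u2 v2 u3 v3) r s) \<in> module_hom K V W"
      if u3: "u3 \<in> carrier U" for u3
      by (rule tensor_lift2_param_hom[OF W V.module_axioms g12[OF u3] bilinear_map_homD(2)[OF g3 u3] r s])
  qed
  note lift2_hom = bilinear_map_homD[OF bilinear_map_tensor_lift2[OF W g12]]
  show "(\<lambda>r. tensor_lift3 W g r s t) \<in> module_hom K T W" if "s \<in> carrier T" "t \<in> carrier T"
    unfolding tensor_lift3_def
    by (rule tensor_lift_param_hom[OF W T.module_axioms lift2 lift2_hom(1) that(2)]) (use that in simp_all)
  show "(\<lambda>s. tensor_lift3 W g r s t) \<in> module_hom K T W" if "r \<in> carrier T" "t \<in> carrier T"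
    unfolding tensor_lift3_def
    by (rule tensor_lift_param_hom[OF W T.module_axioms lift2 lift2_hom(2) that(2)]) (use that in simp_all)
  show "(\<lambda>t. tensor_lift3 W g r s t) \<in> module_hom K T W" if "r \<in> carrier T" "s \<in> carrier T"
    unfolding tensor_lift3_def by (rule tensor_lift_hom[OF W lift2[OF that]])
  show "tensor_lift3 W g (p u1 v1) (p u2 v2) (p u3 v3) = g u1 v1 u2 v2 u3 v3"
    if "u1 \<in> carrier U" "v1 \<in> carrier V" "u2 \<in> carrier U" "v2 \<in> carrier V"
      "u3 \<in> carrier U" "v3 \<in> carrier V"
    unfolding tensor_lift3_def
    using tensor_lift_pure[OF W lift2[OF pure_closed pure_closed] that(5,6)]
      tensor_lift2_pure[OF W g12 that(1-4)] that
    by metis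
qed

section \<open>Multilinear operations are determined by pure tensors\<close>

lemma bilinear_op_tensor_eqI:
  assumes f: "bilinear_op K T f" and g: "bilinear_op K T g"
    and eq: "\<And>u1 v1 u2 v2. u1 \<in> carrier U \<Longrightarrow> v1 \<in> carrier V \<Longrightarrow> u2 \<in> carrier U \<Longrightarrow> v2 \<in> carrier V \<Longrightarrow>
      f (p u1 v1) (p u2 v2) = g (p u1 v1) (p u2 v2)"
    and s: "s \<in> carrier T" and t: "t \<in> carrier T"
  shows "f s t = g s t"
proof -
  \<comment> \<open>The slots are freed one at a time: with a pure second argument both sides are
    linear in \<open>s\<close>; afterwards \<open>s\<close> is fixed and the second argument is
    freed.\<close>
  have eq': "f s (p u2 v2) = g s (p u2 v2)" if "u2 \<in> carrier U" "v2 \<in> carrier V" for u2 v2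
    by (rule module_hom_tensor_eqI[where f = "\<lambda>s. f s (p u2 v2)", OF _ _ _ s])
      (use f g that eq in \<open>auto simp: bilinear_op_def pure_closed\<close>)
  show ?thesis
    by (rule module_hom_tensor_eqI[where f = "f s" and g = "g s", OF _ _ eq' t]) (use f g s in \<open>auto simp: bilinear_op_def\<close>)
qed

lemma trilinear_op_tensor_eqI:
  assumes f: "trilinear_op K T f" and g: "trilinear_op K T g"
    and eq: "\<And>u1 v1 u2 v2 u3 v3. u1 \<in> carrier U \<Longrightarrow> v1 \<in> carrier V \<Longrightarrow> u2 \<in> carrier U \<Longrightarrow> v2 \<in> carrier V \<Longrightarrow>
      u3 \<in> carrier U \<Longrightarrow> v3 \<in> carrier V \<Longrightarrow>
      f (p u1 v1) (p u2 v2) (p u3 v3) = g (p u1 v1) (p u2 v2) (p u3 v3)"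
    and r: "r \<in> carrier T" and s: "s \<in> carrier T" and t: "t \<in> carrier T"
  shows "f r s t = g r s t"
proof -
  have eq': "f r s (p u3 v3) = g r s (p u3 v3)" if "u3 \<in> carrier U" "v3 \<in> carrier V" for u3 v3
    by (rule bilinear_op_tensor_eqI[where f = "\<lambda>r s. f r s (p u3 v3)", OF _ _ _ r s])
      (use f g that eq in \<open>auto simp: bilinear_op_def trilinear_op_def pure_closed\<close>)
  show ?thesis
    by (rule module_hom_tensor_eqI[where f = "f r s" and g = "g r s", OF _ _ eq' t]) (use f g r s in \<open>auto simp: trilinear_op_def\<close>)
qed

end

section \<open>Tensor products of algebras\<close>

lemma bilinear_op_homD:
  assumes "bilinear_op K V f" "x \<in> carrier V"
  shows "(\<lambda>u. f u x) \<in> module_hom K V V" "(\<lambda>u. f x u) \<in> module_hom K V V"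
  using assms by (auto simp: bilinear_op_def)

lemma trilinear_op_homD:
  assumes "trilinear_op K V f" "x \<in> carrier V" "y \<in> carrier V"
  shows "(\<lambda>u. f u x y) \<in> module_hom K V V" "(\<lambda>u. f x u y) \<in> module_hom K V V"
    "(\<lambda>u. f x y u) \<in> module_hom K V V"
  using assms by (auto simp: trilinear_op_def)

lemma bilinear_op_mem:
  "bilinear_op K V f \<Longrightarrow> x \<in> carrier V \<Longrightarrow> y \<in> carrier V \<Longrightarrow> f x y \<in> carrier V"
  by (rule module_hom_mem[OF bilinear_op_homD(1)])

lemma trilinear_op_mem:
  "trilinear_op K V f \<Longrightarrow> x \<in> carrier V \<Longrightarrow> y \<in> carrier V \<Longrightarrow> z \<in> carrier V \<Longrightarrow> f x y z \<in> carrier V"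
  by (rule module_hom_mem[OF trilinear_op_homD(1)])

text \<open>Used for the triple product in the second factor of the bracket formula and again for
  one side of associativity on the tensor product.\<close>

lemma trilinear_op_comp:
  assumes f: "bilinear_op K V f"
  shows "trilinear_op K V (\<lambda>x y z. f (f x y) z)"
  unfolding trilinear_op_def
  by (intro ballI conjI module_hom_compose[OF _ bilinear_op_homD(1)[OF f]] bilinear_op_homD[OF f] bilinear_op_mem[OF f])

lemma (in comm_assoc_algebra) m_closed [simp]: "x \<in> carrier B \<Longrightarrow> y \<in> carrier B \<Longrightarrow> m x y \<in> carrier B"
  by (rule bilinear_op_mem[OF m_bilinear])

lemma (in comm_assoc_algebra) m_left_comm:
  "x \<in> carrier B \<Longrightarrow> y \<in> carrier B \<Longrightarrow> z \<in> carrier B \<Longrightarrow> m x (m y z) = m y (m x z)"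
  by (metis m_assoc m_comm)

lemma (in three_lie_algebra) br_closed [simp]:
  "x \<in> carrier B \<Longrightarrow> y \<in> carrier B \<Longrightarrow> z \<in> carrier B \<Longrightarrow> br x y z \<in> carrier B"
  by (rule trilinear_op_mem[OF br_trilinear])

section \<open>The product and the bracket on the tensor product\<close>

locale tensor_transposed_poisson =
  A: transposed_poisson_3_lie_algebra K B1 m1 br1 + B: comm_assoc_algebra K B2 m2
  for K and B1 and m1 and br1 and B2 and m2
begin

sublocale tensor_modules K B1 B2
  by (intro tensor_modules.intro A.module_axioms B.module_axioms)

definition tmult where
  "tmult = tensor_lift2 T (\<lambda>x1 y1 x2 y2. p (m1 x1 x2) (m2 y1 y2))"

definition tbracket where
  "tbracket = tensor_lift3 T (\<lambda>x1 y1 x2 y2 x3 y3. p (br1 x1 x2 x3) (m2 (m2 y1 y2) y3))"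

lemma is_tensor_mult_tmult: "is_tensor_mult K B1 m1 B2 m2 tmult"
proof -
  have sep: "separately_bilinear T (\<lambda>x1 y1 x2 y2. p (m1 x1 x2) (m2 y1 y2))"
    unfolding separately_bilinear_def
    by (intro ballI conjI bilinear_map_compose[OF bilinear_map_pure]
        bilinear_op_homD[OF A.m_bilinear] bilinear_op_homD[OF B.m_bilinear])
  show ?thesis
    unfolding is_tensor_mult_def bilinear_op_iff tmult_def
    by (intro conjI ballI bilinear_map_tensor_lift2 tensor_lift2_pure T.module_axioms sep)
qed

lemma is_tensor_bracket_tbracket: "is_tensor_bracket K B1 br1 B2 m2 tbracket"
proof -
  let ?g = "\<lambda>x1 y1 x2 y2 x3 y3. p (br1 x1 x2 x3) (m2 (m2 y1 y2) y3)"
  note hom = trilinear_op_homD[OF A.br_trilinear] trilinear_op_homD[OF trilinear_op_comp[OF B.m_bilinear]]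
  have g12: "separately_bilinear T (\<lambda>x1 y1 x2 y2. ?g x1 y1 x2 y2 x3 y3)"
    if "x3 \<in> carrier B1" "y3 \<in> carrier B2" for x3 y3
    unfolding separately_bilinear_def
    by (intro ballI conjI bilinear_map_compose[OF bilinear_map_pure] hom that)
  have g3: "bilinear_map K B1 B2 T (\<lambda>x3 y3. ?g x1 y1 x2 y2 x3 y3)"
    if "x1 \<in> carrier B1" "y1 \<in> carrier B2" "x2 \<in> carrier B1" "y2 \<in> carrier B2" for x1 y1 x2 y2
    by (intro bilinear_map_compose[OF bilinear_map_pure] hom that)
  show ?thesis
    unfolding is_tensor_bracket_def trilinear_op_def tbracket_def
    by (intro conjI ballI tensor_lift3_hom tensor_lift3_pure T.module_axioms g12 g3)
qed

lemma tmult_bilinear: "bilinear_op K T tmult"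
  and tmult_pure: "\<lbrakk>x1 \<in> carrier B1; y1 \<in> carrier B2; x2 \<in> carrier B1; y2 \<in> carrier B2\<rbrakk> \<Longrightarrow>
    tmult (p x1 y1) (p x2 y2) = p (m1 x1 x2) (m2 y1 y2)"
  using is_tensor_mult_tmult by (simp_all add: is_tensor_mult_def)

lemma tbracket_trilinear: "trilinear_op K T tbracket"
  and tbracket_pure: "\<lbrakk>x1 \<in> carrier B1; y1 \<in> carrier B2; x2 \<in> carrier B1; y2 \<in> carrier B2;
      x3 \<in> carrier B1; y3 \<in> carrier B2\<rbrakk> \<Longrightarrow>
    tbracket (p x1 y1) (p x2 y2) (p x3 y3) = p (br1 x1 x2 x3) (m2 (m2 y1 y2) y3)"
  using is_tensor_bracket_tbracket by (simp_all add: is_tensor_bracket_def)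

lemma tmult_unique:
  assumes "is_tensor_mult K B1 m1 B2 m2 \<mu>" "s \<in> carrier T" "t \<in> carrier T"
  shows "\<mu> s t = tmult s t"
  by (rule bilinear_op_tensor_eqI[OF _ tmult_bilinear _ assms(2,3)])
    (use assms(1) in \<open>simp_all add: is_tensor_mult_def tmult_pure\<close>)

lemma tbracket_unique:
  assumes "is_tensor_bracket K B1 br1 B2 m2 \<tau>" "r \<in> carrier T" "s \<in> carrier T" "t \<in> carrier T"
  shows "\<tau> r s t = tbracket r s t"
  by (rule trilinear_op_tensor_eqI[OF _ tbracket_trilinear _ assms(2-4)])
    (use assms(1) in \<open>simp_all add: is_tensor_bracket_def tbracket_pure\<close>)

section \<open>The transposed Poisson axioms on the tensor product\<close>

lemmas tmult_add = bilinear_op_homD[OF tmult_bilinear, THEN module_hom_add]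
lemmas tbracket_add = trilinear_op_homD[OF tbracket_trilinear, THEN module_hom_add]
lemmas pure_add = bilinear_map_homD(1)[OF bilinear_map_pure, THEN module_hom_add]

lemma pure_uminus:
  assumes "x \<in> carrier B1" "y \<in> carrier B2"
  shows "p (\<ominus>\<^bsub>B1\<^esub> x) y = \<ominus>\<^bsub>T\<^esub> p x y"
proof -
  interpret h: mod_hom K B1 T "\<lambda>x. p x y"
    by unfold_locales (rule bilinear_map_homD(1)[OF bilinear_map_pure assms(2)])
  show ?thesis by (rule h.f_neg[OF assms(1)])
qed

lemma tmult_closed: "\<lbrakk>s \<in> carrier T; t \<in> carrier T\<rbrakk> \<Longrightarrow> tmult s t \<in> carrier T"
  by (rule bilinear_op_mem[OF tmult_bilinear])

lemma tbracket_closed: "\<lbrakk>r \<in> carrier T; s \<in> carrier T; t \<in> carrier T\<rbrakk> \<Longrightarrow> tbracket r s t \<in> carrier T"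
  by (rule trilinear_op_mem[OF tbracket_trilinear])

lemma tmult_comm:
  assumes "s \<in> carrier T" "t \<in> carrier T"
  shows "tmult s t = tmult t s"
  by (rule bilinear_op_tensor_eqI[OF tmult_bilinear _ _ assms])
    (use tmult_bilinear in \<open>simp_all add: bilinear_op_def tmult_pure A.m_comm B.m_comm\<close>)

lemma tmult_assoc:
  assumes "r \<in> carrier T" "s \<in> carrier T" "t \<in> carrier T"
  shows "tmult (tmult r s) t = tmult r (tmult s t)"
proof (rule trilinear_op_tensor_eqI[OF trilinear_op_comp[OF tmult_bilinear] _ _ assms])
  note hom = bilinear_op_homD[OF tmult_bilinear]
  show "trilinear_op K T (\<lambda>r s t. tmult r (tmult s t))"
    unfolding trilinear_op_def
    by (intro ballI conjI module_hom_compose[OF _ hom(2)] hom tmult_closed)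
qed (simp add: tmult_pure A.m_assoc B.m_assoc)

text \<open>The sign comes from \<open>br1\<close> alone and leaves the pure tensor by linearity in
  its first factor; the product of the second components is symmetric.\<close>

lemma tbracket_skew:
  assumes "r \<in> carrier T" "s \<in> carrier T" "t \<in> carrier T"
  shows "tbracket s r t = \<ominus>\<^bsub>T\<^esub> tbracket r s t"
    and "tbracket r t s = \<ominus>\<^bsub>T\<^esub> tbracket r s t"
proof -
  note hom = trilinear_op_homD[OF tbracket_trilinear]
  have neg: "trilinear_op K T (\<lambda>r s t. \<ominus>\<^bsub>T\<^esub> tbracket r s t)"
    unfolding trilinear_op_def by (intro ballI conjI T.module_hom_uminus hom)
  show "tbracket s r t = \<ominus>\<^bsub>T\<^esub> tbracket r s t"
  proof (rule trilinear_op_tensor_eqI[OF _ neg _ assms])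
    show "trilinear_op K T (\<lambda>r s t. tbracket s r t)"
      unfolding trilinear_op_def by (intro ballI conjI hom)
    fix u1 v1 u2 v2 u3 v3
    assume "u1 \<in> carrier B1" "v1 \<in> carrier B2" "u2 \<in> carrier B1" "v2 \<in> carrier B2"
      "u3 \<in> carrier B1" "v3 \<in> carrier B2"
    then show "tbracket (p u2 v2) (p u1 v1) (p u3 v3) = \<ominus>\<^bsub>T\<^esub> tbracket (p u1 v1) (p u2 v2) (p u3 v3)"
      by (simp add: tbracket_pure A.br_skew12[of u1 u2] B.m_comm[of v2] pure_uminus)
  qed
  show "tbracket r t s = \<ominus>\<^bsub>T\<^esub> tbracket r s t"
  proof (rule trilinear_op_tensor_eqI[OF _ neg _ assms])
    show "trilinear_op K T (\<lambda>r s t. tbracket r t s)"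
      unfolding trilinear_op_def by (intro ballI conjI hom)
    fix u1 v1 u2 v2 u3 v3
    assume "u1 \<in> carrier B1" "v1 \<in> carrier B2" "u2 \<in> carrier B1" "v2 \<in> carrier B2"
      "u3 \<in> carrier B1" "v3 \<in> carrier B2"
    then show "tbracket (p u1 v1) (p u3 v3) (p u2 v2) = \<ominus>\<^bsub>T\<^esub> tbracket (p u1 v1) (p u2 v2) (p u3 v3)"
      by (simp add: tbracket_pure A.br_skew23[of u1 u2] B.m_assoc B.m_comm[of v2] pure_uminus)
  qed
qed

text \<open>The arguments become pure one after another. Each sum case splits both sides by
  additivity of the bracket and reorders the summands.\<close>

lemma tbracket_fundamental:
  assumes t1: "t1 \<in> carrier T" and t2: "t2 \<in> carrier T" and t3: "t3 \<in> carrier T"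
    and t4: "t4 \<in> carrier T" and t5: "t5 \<in> carrier T"
  shows "tbracket t1 t2 (tbracket t3 t4 t5) =
    tbracket (tbracket t1 t2 t3) t4 t5 \<oplus>\<^bsub>T\<^esub> tbracket t3 (tbracket t1 t2 t4) t5 \<oplus>\<^bsub>T\<^esub>
    tbracket t3 t4 (tbracket t1 t2 t5)"
proof -
  note add = tbracket_add tbracket_closed T.M.a_ac
  show ?thesis using t1
  proof (induction rule: tensor_induct)
    case (pure x1 y1)
    \<comment> \<open>Both forms are kept: the innermost computation needs the membership of the
      components, the sum cases that of the pure tensor.\<close>
    note p1 = pure pure_closed[OF pure]
    show ?case using t2
    proof (induction rule: tensor_induct)
      case (pure x2 y2)
      note p2 = pure pure_closed[OF pure]
      show ?case using t3
      proof (induction rule: tensor_induct)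
        case (pure x3 y3)
        note p3 = pure pure_closed[OF pure]
        show ?case using t4
        proof (induction rule: tensor_induct)
          case (pure x4 y4)
          note p4 = pure pure_closed[OF pure]
          show ?case using t5
          proof (induction rule: tensor_induct)
            case (pure x5 y5)
            note pp = p1(1,2) p2(1,2) p3(1,2) p4(1,2) pure
            \<comment> \<open>The second components of the three right-hand terms are brought to the
              grouping that occurs on the left. Only with a common second component can
              \<open>pure_add\<close> merge the terms, so that the fundamental identity of
              \<open>br1\<close> applies in the first.\<close>
            have y: "m2 (m2 (m2 (m2 y1 y2) y3) y4) y5 = m2 (m2 y1 y2) (m2 (m2 y3 y4) y5)"
              "m2 (m2 y3 (m2 (m2 y1 y2) y4)) y5 = m2 (m2 y1 y2) (m2 (m2 y3 y4) y5)"
              "m2 (m2 y3 y4) (m2 (m2 y1 y2) y5) = m2 (m2 y1 y2) (m2 (m2 y3 y4) y5)"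
              using pp by (simp_all add: B.m_assoc B.m_comm B.m_left_comm)
            show ?case
              using pp by (simp add: tbracket_pure y A.br_fundamental[OF pp(1,3,5,7,9)] pure_add)
          qed (use p1 p2 p3 p4 in \<open>simp add: add\<close>)
        qed (use p1 p2 p3 t5 in \<open>simp add: add\<close>)
      qed (use p1 p2 t4 t5 in \<open>simp add: add\<close>)
    qed (use p1 t3 t4 t5 in \<open>simp add: add\<close>)
  qed (use t2 t3 t4 t5 in \<open>simp add: add\<close>)
qed

lemma tmult_transposed_leibniz:
  assumes w: "w \<in> carrier T" and r: "r \<in> carrier T" and s: "s \<in> carrier T" and t: "t \<in> carrier T"
  shows "[(3::nat)] \<cdot>\<^bsub>T\<^esub> tmult w (tbracket r s t) =
    tbracket (tmult w r) s t \<oplus>\<^bsub>T\<^esub> tbracket r (tmult w s) t \<oplus>\<^bsub>T\<^esub> tbracket r s (tmult w t)"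
proof -
  \<comment> \<open>The multiple by 3 is an additive power, so \<open>nat_pow_distrib\<close>
    carries it across sums in the inductions.\<close>
  note add = tbracket_add tbracket_closed tmult_add tmult_closed T.M.add.nat_pow_distrib T.M.a_ac
  show ?thesis using w
  proof (induction rule: tensor_induct)
    case (pure x0 y0)
    note p0 = pure pure_closed[OF pure]
    show ?case using r
    proof (induction rule: tensor_induct)
      case (pure x1 y1)
      note p1 = pure pure_closed[OF pure]
      show ?case using s
      proof (induction rule: tensor_induct)
        case (pure x2 y2)
        note p2 = pure pure_closed[OF pure]
        show ?case using t
        proof (induction rule: tensor_induct)
          case (pure x3 y3)
          note pp = p0(1,2) p1(1,2) p2(1,2) pure
          \<comment> \<open>Threefold addition moves into the first component by
            \<open>pure_add\<close>; there it meets the factor 3 of the identity in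
            \<open>B1\<close>.\<close>
          have three: "[(3::nat)] \<cdot>\<^bsub>T\<^esub> p x y = p ([(3::nat)] \<cdot>\<^bsub>B1\<^esub> x) y"
            if "x \<in> carrier B1" "y \<in> carrier B2" for x y
            using that by (simp add: numeral_3_eq_3 pure_add pure_closed)
          have y: "m2 (m2 (m2 y0 y1) y2) y3 = m2 y0 (m2 (m2 y1 y2) y3)"
            "m2 (m2 y1 (m2 y0 y2)) y3 = m2 y0 (m2 (m2 y1 y2) y3)"
            "m2 (m2 y1 y2) (m2 y0 y3) = m2 y0 (m2 (m2 y1 y2) y3)"
            using pp by (simp_all add: B.m_assoc B.m_comm B.m_left_comm)
          show ?case
            using pp by (simp add: tbracket_pure tmult_pure y three A.transposed_leibniz pure_add)
        qed (use p0 p1 p2 in \<open>simp add: add\<close>)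
      qed (use p0 p1 t in \<open>simp add: add\<close>)
    qed (use p0 s t in \<open>simp add: add\<close>)
  qed (use r s t in \<open>simp add: add\<close>)
qed

lemma transposed_poisson_tensor: "transposed_poisson_3_lie_algebra K T tmult tbracket"
proof -
  have "vectorspace K T"
    by (intro vectorspace.intro T.module_axioms A.field_axioms)
  then show ?thesis
    by (intro transposed_poisson_3_lie_algebra.intro transposed_poisson_3_lie_algebra_axioms.intro
        comm_assoc_algebra.intro comm_assoc_algebra_axioms.intro
        three_lie_algebra.intro three_lie_algebra_axioms.intro
        tmult_bilinear tmult_comm tmult_assoc tbracket_trilinear tbracket_skew
        tbracket_fundamental tmult_transposed_leibniz)
qed

end

text \<open>Prescribing values on pure tensors defines operations only if multilinear extensions
  exist and are unique. Both facts are therefore part of the conclusion, with uniqueness understood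
  on the carrier.\<close>

theorem proposition3p4:
  fixes K :: "('a, 'm) ring_scheme"
    and B1 :: "('a, 'b, 'n) module_scheme"
    and m1 :: "'b \<Rightarrow> 'b \<Rightarrow> 'b"
    and br1 :: "'b \<Rightarrow> 'b \<Rightarrow> 'b \<Rightarrow> 'b"
    and B2 :: "('a, 'c, 'p) module_scheme"
    and m2 :: "'c \<Rightarrow> 'c \<Rightarrow> 'c"
  assumes "field K" and "char_zero_ring K"
    and "transposed_poisson_3_lie_algebra K B1 m1 br1" and "vectorspace.fin_dim K B1"
    and "comm_assoc_algebra K B2 m2" and "vectorspace.fin_dim K B2"
  shows "\<exists>\<mu> \<tau>.
    is_tensor_mult K B1 m1 B2 m2 \<mu> \<and>
    (\<forall>\<mu>'. is_tensor_mult K B1 m1 B2 m2 \<mu>' \<longrightarrow>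
       (\<forall>s \<in> carrier (tensor_space K B1 B2). \<forall>t \<in> carrier (tensor_space K B1 B2).
          \<mu>' s t = \<mu> s t)) \<and>
    is_tensor_bracket K B1 br1 B2 m2 \<tau> \<and>
    (\<forall>\<tau>'. is_tensor_bracket K B1 br1 B2 m2 \<tau>' \<longrightarrow>
       (\<forall>r \<in> carrier (tensor_space K B1 B2). \<forall>s \<in> carrier (tensor_space K B1 B2).
        \<forall>t \<in> carrier (tensor_space K B1 B2). \<tau>' r s t = \<tau> r s t)) \<and>
    transposed_poisson_3_lie_algebra K (tensor_space K B1 B2) \<mu> \<tau>"
proof -
  interpret tensor_transposed_poisson K B1 m1 br1 B2 m2
    by (intro tensor_transposed_poisson.intro assms)
  show ?thesis
    by (intro exI[of _ tmult] exI[of _ tbracket] conjI allI impI ballI is_tensor_mult_tmult tmult_unique is_tensor_bracket_tbracket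
        tbracket_unique transposed_poisson_tensor)
qed

end
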